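(* No $[10,10,16]_{\mathbb{Z}}$ formula is a restriction of any Hurwitz–Radon formula.
   Context: All norms are Euclidean. For positive integers $r,s,n$, an $[r,s,n]_{\mathbb{R}}$ formula is (equivalently) a normed bilinear map of size $[r,s,n]$, i.e. an $\mathbb{R}$-bilinear map $f:\mathbb{R}^r\times\mathbb{R}^s\to\mathbb{R}^n$ with $|f(x,y)|=|x|\,|y|$ for all $x\in\mathbb{R}^r$, $y\in\mathbb{R}^s$. Writing $f=(z_1,\dots,z_n)$, each $z_k(x,y)$ is a bilinear form in the coordinates of $x$ and $y$. An $[r,s,n]_{\mathbb{Z}}$ formula is such a formula in which every $z_k$ has integer coefficients (with respect to the standard coordinates). Hurwitz–Radon function and formulas: for a positive integer $m=2^{4a+b}m_0$ with $m_0$ odd, $a\ge 0$ and $0\le b\le 3$, put $\rho(m)=8a+2^b$. A Hurwitz–Radon formula is a $[\rho(m),m,m]_{\mathbb{R}}$ formula for some positive integer $m$. Restriction: Let $F:\mathbb{R}^h\times\mathbb{R}^m\to\mathbb{R}^m$ be a normed bilinear map. A normed bilinear map $g:\mathbb{R}^r\times\mathbb{R}^s\to\mathbb{R}^n$ is a restriction of $F$ if there are linear subspaces $X\subseteq\mathbb{R}^h$, $Y\subseteq\mathbb{R}^m$, $Z\subseteq\mathbb{R}^m$ of dimensions $r,s,n$ respectively with $F(X\times Y)\subseteq Z$, and linear isometries (onto) $\alpha:\mathbb{R}^r\to X$, $\beta:\mathbb{R}^s\to Y$, $\gamma:\mathbb{R}^n\to Z$ such that $\gamma(g(x,y))=F(\alpha(x),\beta(y))$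 for all $x\in\mathbb{R}^r$, $y\in\mathbb{R}^s$. *)

theory Defs
  imports "HOL-Analysis.Analysis"
begin

text \<open>
  Maps of size \<open>[r, s, n]\<close> are curried functions \<open>real^'r \<Rightarrow> real^'s \<Rightarrow> real^'n\<close> with
  \<open>CARD('r) = r\<close>, \<open>CARD('s) = s\<close> and \<open>CARD('n) = n\<close>; all norms are Euclidean.
\<close>

definition real_formula :: "(real^'r \<Rightarrow> real^'s \<Rightarrow> real^'n) \<Rightarrow> bool" where
  "real_formula f \<longleftrightarrow> bilinear f \<and> (\<forall>x y. norm (f x y) = norm x * norm y)"

definition integer_formula :: "(real^'r \<Rightarrow> real^'s \<Rightarrow> real^'n) \<Rightarrow> bool" where
  "integer_formula f \<longleftrightarrow> real_formula f \<and>
     (\<forall>k. \<exists>c :: 'r \<Rightarrow> 's \<Rightarrow> int. \<forall>x y.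
        f x y $ k = (\<Sum>i\<in>UNIV. \<Sum>j\<in>UNIV. of_int (c i j) * x $ i * y $ j))"

text \<open>The Hurwitz--Radon function, meaningful for positive arguments only.\<close>

definition hurwitz_radon :: "nat \<Rightarrow> nat" where
  "hurwitz_radon m = (let v = multiplicity 2 m in 8 * (v div 4) + 2 ^ (v mod 4))"

lemma hurwitz_radon_eq:
  assumes "odd m0" and "b \<le> 3"
  shows "hurwitz_radon (2 ^ (4 * a + b) * m0) = 8 * a + 2 ^ b"
proof -
  have "multiplicity 2 (2 ^ (4 * a + b) * m0) = 4 * a + b"
    using assms(1) by (intro multiplicity_eqI) (auto simp: mult.commute)
  with assms(2) show ?thesis
    by (simp add: hurwitz_radon_def)
qed

definition hurwitz_radon_formula :: "(real^'h \<Rightarrow> real^'m \<Rightarrow> real^'m) \<Rightarrow> bool" where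
  "hurwitz_radon_formula F \<longleftrightarrow> real_formula F \<and> CARD('h) = hurwitz_radon CARD('m)"

definition linear_isometry_onto ::
    "('a::real_normed_vector \<Rightarrow> 'b::real_normed_vector) \<Rightarrow> 'b set \<Rightarrow> bool" where
  "linear_isometry_onto \<alpha> X \<longleftrightarrow> linear \<alpha> \<and> (\<forall>x. norm (\<alpha> x) = norm x) \<and> range \<alpha> = X"

definition is_restriction ::
    "(real^'r \<Rightarrow> real^'s \<Rightarrow> real^'n) \<Rightarrow> (real^'h \<Rightarrow> real^'m \<Rightarrow> real^'m) \<Rightarrow> bool" where
  "is_restriction g F \<longleftrightarrow>
     (\<exists>X Y Z \<alpha> \<beta> \<gamma>.
        subspace X \<and> subspace Y \<and> subspace Z \<and>
        dim X = CARD('r) \<and> dim Y = CARD('s) \<and> dim Z = CARD('n) \<and>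
        (\<forall>x\<in>X. \<forall>y\<in>Y. F x y \<in> Z) \<and>
        linear_isometry_onto \<alpha> X \<and> linear_isometry_onto \<beta> Y \<and> linear_isometry_onto \<gamma> Z \<and>
        (\<forall>x y. \<gamma> (g x y) = F (\<alpha> x) (\<beta> y)))"

end

theory Submission
  imports Defs
begin

text \<open>
  Write \<open>A\<^sub>i = F (\<alpha> e\<^sub>i)\<close>. The nine maps \<open>B\<^sub>i = A\<^sub>0\<^sup>T A\<^sub>i\<close> square to \<open>-1\<close> and
  anticommute. Integrality makes every \<open>g e\<^sub>i e\<^sub>j\<close> a signed basis vector, so the ten lines
  \<open>\<plusminus>\<beta> e\<^sub>j\<close> and their images under all \<open>B\<^sub>i\<close> lie among 16 lines. Each of the ten lines has ten
  such neighbours (itself included), so any two of them have a common one; hence all ten lie in the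
  orbit of a single line \<open>\<plusminus>y\<close> under the products \<open>B\<^sub>S\<close>, where \<open>S\<close> is a set of indices. The sets
  \<open>S\<close> with \<open>B\<^sub>S y = \<plusminus>y\<close> form a binary code of length 9 whose weights are 0 or 3 modulo 4, because
  \<open>B\<^sub>S\<close> must square to 1. Such a code has dimension at most 4, so at least 5 indices are
  independent modulo it and the orbit is a hypercube of dimension at least 5. There the closed
  neighbourhood of 10 vertices has at least 20 elements, which exceeds 16.
\<close>

section \<open>Neighbourhoods in the hypercube\<close>

text \<open>The closed neighbourhood in the hypercube graph on \<open>Pow I\<close>, that is,
  Hamming distance at most 1.\<close>

definition nbhd :: "'a set \<Rightarrow> 'a set set \<Rightarrow> 'a set set" where
  "nbhd I \<B> = \<B> \<union> (\<Union>i\<in>I. (\<lambda>S. sym_diff S {i}) ` \<B>)"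

lemma nbhd_subset_Pow: "\<B> \<subseteq> Pow I \<Longrightarrow> nbhd I \<B> \<subseteq> Pow I"
  by (auto simp: nbhd_def)

text \<open>Coordinate \<open>x\<close> splits the cube into two facets, each a copy of
  \<open>Pow I\<close>. In either facet the neighbourhood contains the neighbourhood of the part
  lying there and, since flipping \<open>x\<close> is also a step, a copy of the opposite part. Each
  of these two sets bounds the count in that facet, whence the maxima.\<close>

lemma card_nbhd_insert:
  assumes "finite I" "x \<notin> I" and \<B>: "\<B> \<subseteq> Pow (insert x I)"
  obtains \<B>0 \<B>1 where "\<B>0 \<subseteq> Pow I" "\<B>1 \<subseteq> Pow I" "card \<B>0 + card \<B>1 = card \<B>"
    "max (card (nbhd I \<B>0)) (card \<B>1) + max (card (nbhd I \<B>1)) (card \<B>0)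
       \<le> card (nbhd (insert x I) \<B>)"
proof
  define \<B>0 where "\<B>0 = {S \<in> \<B>. x \<notin> S}"
  define \<B>1 where "\<B>1 = (\<lambda>S. S - {x}) ` {S \<in> \<B>. x \<in> S}"
  show sub: "\<B>0 \<subseteq> Pow I" "\<B>1 \<subseteq> Pow I"
    using \<B> by (auto simp: \<B>0_def \<B>1_def)
  have inj: "inj_on (insert x) (Pow I)"
    using \<open>x \<notin> I\<close> by (intro inj_onI) (auto simp: set_eq_iff)
  have B1: "insert x ` \<B>1 = {S \<in> \<B>. x \<in> S}"
    by (auto simp: \<B>1_def image_image insert_absorb)
  have fin: "finite (Pow I)" "finite (Pow (insert x I))"
    using \<open>finite I\<close> by auto
  have finB: "finite \<B>0" "finite \<B>1" "finite \<B>"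
    using sub \<B> fin by (auto dest: finite_subset)
  have "card \<B> = card \<B>0 + card (insert x ` \<B>1)"
    unfolding B1 \<B>0_def using finB(3)
    by (subst card_Un_disjoint[symmetric]) (auto intro: arg_cong[where f=card])
  also have "card (insert x ` \<B>1) = card \<B>1"
    using inj sub by (meson card_image inj_on_subset)
  finally show "card \<B>0 + card \<B>1 = card \<B>" by simp
  \<comment> \<open>\<open>L\<close> lies in the facet without \<open>x\<close>; \<open>U\<close>
    lies in the opposite one once \<open>x\<close> is inserted into its members.\<close>
  define L where "L = nbhd I \<B>0 \<union> \<B>1"
  define U where "U = nbhd I \<B>1 \<union> \<B>0"
  have LU: "L \<subseteq> Pow I" "U \<subseteq> Pow I"
    using sub nbhd_subset_Pow unfolding L_def U_def by blast+
  have finL: "finite L" "finite U"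
    using LU fin by (auto dest: finite_subset)
  have 1: "nbhd I \<B>0 \<subseteq> nbhd (insert x I) \<B>"
    by (auto simp: nbhd_def \<B>0_def)
  have 2: "\<B>1 \<subseteq> nbhd (insert x I) \<B>"
    by (auto simp: nbhd_def \<B>1_def)
  have 3: "insert x ` \<B>0 \<subseteq> nbhd (insert x I) \<B>"
  proof
    fix T assume "T \<in> insert x ` \<B>0"
    then obtain S where "S \<in> \<B>" "x \<notin> S" "T = sym_diff S {x}"
      by (auto simp: \<B>0_def)
    then show "T \<in> nbhd (insert x I) \<B>"
      unfolding nbhd_def by blast
  qed
  have 4: "insert x ` nbhd I \<B>1 \<subseteq> nbhd (insert x I) \<B>"
  proof
    fix T assume "T \<in> insert x ` nbhd I \<B>1"
    then obtain S where S: "S \<in> nbhd I \<B>1" "T = insert x S" by auto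
    show "T \<in> nbhd (insert x I) \<B>"
    proof (cases "S \<in> \<B>1")
      case True
      then have "T \<in> \<B>" using S B1 by blast
      then show ?thesis by (simp add: nbhd_def)
    next
      case False
      then obtain i R where R: "i \<in> I" "R \<in> \<B>1" "S = sym_diff R {i}"
        using S by (auto simp: nbhd_def)
      have "i \<noteq> x" using R \<open>x \<notin> I\<close> by auto
      then have "T = sym_diff (insert x R) {i}" using S R by auto
      moreover have "insert x R \<in> \<B>" using R B1 by blast
      ultimately show ?thesis
        using R unfolding nbhd_def by blast
    qed
  qed
  have "card L + card U = card L + card (insert x ` U)"
    using inj LU by (metis card_image inj_on_subset)
  also have "\<dots> = card (L \<union> insert x ` U)"
    using finL LU \<open>x \<notin> I\<close> by (intro card_Un_disjoint[symmetric]) auto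
  also have "\<dots> \<le> card (nbhd (insert x I) \<B>)"
  proof (rule card_mono)
    show "finite (nbhd (insert x I) \<B>)"
      using nbhd_subset_Pow[OF \<B>] fin(2) by (rule finite_subset)
    show "L \<union> insert x ` U \<subseteq> nbhd (insert x I) \<B>"
      using 1 2 3 4 by (auto simp: L_def U_def)
  qed
  finally have "card L + card U \<le> card (nbhd (insert x I) \<B>)" .
  moreover have "max (card (nbhd I \<B>0)) (card \<B>1) \<le> card L" "max (card (nbhd I \<B>1)) (card \<B>0) \<le> card U"
    using finL by (auto simp: L_def U_def intro!: card_mono)
  ultimately show "max (card (nbhd I \<B>0)) (card \<B>1) + max (card (nbhd I \<B>1)) (card \<B>0)
       \<le> card (nbhd (insert x I) \<B>)" by linarith
qed

text \<open>
  Row \<open>d\<close> is the lower bound for \<open>card (nbhd I \<B>)\<close> in dimension \<open>d = card I\<close>, as a function of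
  \<open>card \<B> \<le> 10\<close>, that results from \<open>card_nbhd_insert\<close> by minimising over all
  splittings of \<open>card \<B>\<close>.
\<close>

definition nbhd_bound :: "nat list list" where
  "nbhd_bound =
    [[0, 1, 2, 3, 4, 5, 6, 7, 8, 9, 10],
     [0, 2, 2, 4, 4, 6, 6, 8, 8, 10, 10],
     [0, 3, 4, 4, 4, 7, 8, 8, 8, 11, 12],
     [0, 4, 6, 7, 7, 8, 8, 8, 8, 12, 14],
     [0, 5, 8, 10, 11, 11, 13, 14, 14, 15, 15],
     [0, 6, 10, 13, 15, 16, 16, 19, 21, 22, 22]]"

lemma nbhd_bound_0: "b \<le> 10 \<Longrightarrow> nbhd_bound ! 0 ! b = b"
  by (auto simp: nbhd_bound_def le_Suc_eq numeral_eq_Suc)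

text \<open>The factor 2 fails in row 4, where ten vertices are only guaranteed 15; hence the search
  for five independent indices.\<close>

lemma nbhd_bound_5: "b \<le> 10 \<Longrightarrow> 2 * b \<le> nbhd_bound ! 5 ! b"
  by (auto simp: nbhd_bound_def le_Suc_eq numeral_eq_Suc)

lemma nbhd_bound_Suc:
  assumes "d < 5" "a + c \<le> 10"
  shows "nbhd_bound ! Suc d ! (a + c)
    \<le> max (nbhd_bound ! d ! a) c + max (nbhd_bound ! d ! c) a"
proof -
  \<comment> \<open>The range \<open>[0..<11-a]\<close> keeps \<open>a + c\<close> at most 10, the
    last index of a row.\<close>
  have "list_all (\<lambda>d. list_all (\<lambda>a. list_all (\<lambda>c. nbhd_bound ! Suc d ! (a + c)
    \<le> max (nbhd_bound ! d ! a) c + max (nbhd_bound ! d ! c) a) [0..<11-a]) [0..<11]) [0..<5]"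
    by code_simp
  then show ?thesis using assms unfolding list_all_iff by auto
qed

lemma card_nbhd_ge_bound:
  assumes "finite I" "card I \<le> 5" "\<B> \<subseteq> Pow I" "card \<B> \<le> 10"
  shows "nbhd_bound ! card I ! card \<B> \<le> card (nbhd I \<B>)"
  using assms
proof (induction I arbitrary: \<B> rule: finite_induct)
  case empty
  then show ?case by (simp add: nbhd_bound_0 nbhd_def)
next
  case (insert x I)
  obtain \<B>0 \<B>1 where *: "\<B>0 \<subseteq> Pow I" "\<B>1 \<subseteq> Pow I" "card \<B>0 + card \<B>1 = card \<B>"
    "max (card (nbhd I \<B>0)) (card \<B>1) + max (card (nbhd I \<B>1)) (card \<B>0)
       \<le> card (nbhd (insert x I) \<B>)"
    by (rule card_nbhd_insert[OF insert.hyps(1,2) insert.prems(2)]) blast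
  have "nbhd_bound ! card I ! card \<B>0 \<le> card (nbhd I \<B>0)"
    "nbhd_bound ! card I ! card \<B>1 \<le> card (nbhd I \<B>1)"
    using insert * by auto
  moreover have "nbhd_bound ! Suc (card I) ! (card \<B>0 + card \<B>1)
    \<le> max (nbhd_bound ! card I ! card \<B>0) (card \<B>1) + max (nbhd_bound ! card I ! card \<B>1) (card \<B>0)"
    using insert * by (intro nbhd_bound_Suc) auto
  ultimately show ?case using * insert.hyps by simp
qed

text \<open>Dimension 5 is read off the table. Beyond it, a bound linear in \<open>card \<B>\<close>
  passes from the two facets to the cube by addition.\<close>

lemma card_nbhd_ge:
  assumes "finite I" "5 \<le> card I" "\<B> \<subseteq> Pow I" "card \<B> \<le> 10"
  shows "2 * card \<B> \<le> card (nbhd I \<B>)"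
  using assms
proof (induction I arbitrary: \<B> rule: finite_induct)
  case empty
  then show ?case by simp
next
  case (insert x I)
  show ?case
  proof (cases "card (insert x I) = 5")
    case True
    then have "nbhd_bound ! 5 ! card \<B> \<le> card (nbhd (insert x I) \<B>)"
      using card_nbhd_ge_bound[of "insert x I" \<B>] insert by auto
    then show ?thesis
      using nbhd_bound_5 insert.prems le_trans by blast
  next
    case False
    obtain \<B>0 \<B>1 where *: "\<B>0 \<subseteq> Pow I" "\<B>1 \<subseteq> Pow I" "card \<B>0 + card \<B>1 = card \<B>"
      "max (card (nbhd I \<B>0)) (card \<B>1) + max (card (nbhd I \<B>1)) (card \<B>0)
         \<le> card (nbhd (insert x I) \<B>)"
      by (rule card_nbhd_insert[OF insert.hyps(1,2) insert.prems(2)]) blast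
    have "2 * card \<B>0 \<le> card (nbhd I \<B>0)" "2 * card \<B>1 \<le> card (nbhd I \<B>1)"
      using insert * False by auto
    then show ?thesis using * by linarith
  qed
qed

section \<open>Binary codes of length 9 with weights 0 or 3 modulo 4\<close>

lemma card_eq_sum_of_bool:
  assumes "S \<subseteq> I" "finite I"
  shows "card S = (\<Sum>i\<in>I. of_bool (i \<in> S))"
  using assms by (simp add: sum.If_cases of_bool_def Int_absorb1)

text \<open>
  Subsets of a four-element set are represented by their characteristic vectors, so that
  \<open>no_five_subsets\<close> becomes a finite search.
\<close>

definition weight :: "bool list \<Rightarrow> nat" where
  "weight xs = sum_list (map of_bool xs)"

definition near :: "bool list \<Rightarrow> bool list \<Rightarrow> bool" where
  "near xs ys \<longleftrightarrow> weight (map2 (\<noteq>) xs ys) \<in> {1, 2}"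

definition middle_vectors :: "bool list list" where
  "middle_vectors = filter (\<lambda>xs. weight xs \<in> {2, 3}) (product_lists (replicate 4 [True, False]))"

text \<open>A clique search among ten vectors, the pairs and triples in a four-element set. In a
  clique the pairs meet each other and every triple contains every pair. Three pairs allow at most
  one triple, two pairs one triple, one pair two triples, and there are four triples in all; so
  cliques have at most four members.\<close>

lemma no_five_near_vectors:
  assumes in_mid: "p \<in> set middle_vectors" "q \<in> set middle_vectors" "r \<in> set middle_vectors"
      "s \<in> set middle_vectors" "t \<in> set middle_vectors"
    and near: "near p q" "near p r" "near p s" "near p t" "near q r" "near q s" "near q t"
      "near r s" "near r t" "near s t"
  shows False
proof -
  have "list_all (\<lambda>p. let P = filter (near p) middle_vectors in
     list_all (\<lambda>q. let Q = filter (near q) P in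
     list_all (\<lambda>r. let R = filter (near r) Q in
     list_all (\<lambda>s. filter (near s) R = []) R) Q) P) middle_vectors"
    by code_simp
  then show False
    using assms unfolding list_all_iff Let_def filter_empty_conv set_filter by blast
qed

text \<open>Rules out a code of dimension 5: the sets \<open>S j\<close> are the right-hand blocks
  of the rows of a generator matrix in systematic form, with five leading and four remaining
  columns.\<close>

lemma no_five_subsets:
  fixes S :: "'j \<Rightarrow> 'a set"
  assumes "finite I" "card I = 4" "card J = 5"
    and sub: "\<And>j. j \<in> J \<Longrightarrow> S j \<subseteq> I"
    and c: "\<And>j. j \<in> J \<Longrightarrow> card (S j) \<in> {2, 3}"
    and d: "\<And>j k. j \<in> J \<Longrightarrow> k \<in> J \<Longrightarrow> j \<noteq> k \<Longrightarrow> card (sym_diff (S j) (S k)) \<in> {1, 2}"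
  shows False
proof -
  obtain xs where xs: "set xs = I" "distinct xs" "length xs = 4"
    using finite_distinct_list[OF \<open>finite I\<close>] \<open>card I = 4\<close> distinct_card by metis
  then obtain a b c d where "xs = [a,b,c,d]"
    by (auto simp: length_Suc_conv numeral_eq_Suc)
  with xs have I: "I = {a,b,c,d}" and di: "distinct [a,b,c,d]" by auto
  have "finite J" using \<open>card J = 5\<close> by (simp add: card_ge_0_finite)
  then obtain js where js: "set js = J" "distinct js" "length js = 5"
    using finite_distinct_list \<open>card J = 5\<close> distinct_card by metis
  then obtain j k l m n where "js = [j,k,l,m,n]"
    by (auto simp: length_Suc_conv numeral_eq_Suc)
  with js have J: "J = {j,k,l,m,n}" and dj: "distinct [j,k,l,m,n]" by auto
  define v where "v i = map (\<lambda>x. x \<in> S i) [a,b,c,d]" for i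
  have card_v: "card T = weight (map (\<lambda>x. x \<in> T) [a,b,c,d])" if "T \<subseteq> I" for T
    using card_eq_sum_of_bool[OF that \<open>finite I\<close>] di by (simp add: I weight_def)
  have v1: "v i \<in> set middle_vectors" if "i \<in> J" for i
  proof -
    have "v i \<in> set (product_lists (replicate 4 [True, False]))"
      by (cases "a \<in> S i"; cases "b \<in> S i"; cases "c \<in> S i"; cases "d \<in> S i")
        (simp_all add: v_def numeral_eq_Suc)
    then show ?thesis
      using c[OF that] card_v[OF sub[OF that]] by (simp add: v_def middle_vectors_def)
  qed
  have v2: "near (v i) (v i')" if "i \<in> J" "i' \<in> J" "i \<noteq> i'" for i i'
  proof -
    have "card (sym_diff (S i) (S i')) = weight (map (\<lambda>x. x \<in> sym_diff (S i) (S i')) [a,b,c,d])"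
      using sub that by (intro card_v) blast
    also have "map (\<lambda>x. x \<in> sym_diff (S i) (S i')) [a,b,c,d] = map2 (\<noteq>) (v i) (v i')"
      by (auto simp: v_def)
    finally show ?thesis using d[OF that] by (simp add: near_def)
  qed
  show False
    using dj by (intro no_five_near_vectors[of "v j" "v k" "v l" "v m" "v n"] v1 v2) (auto simp: J)
qed

text \<open>A maximal \<open>I\<close> containing no nonempty codeword is a basis of the space of
  subsets of \<open>K\<close> modulo \<open>C\<close>. If it had fewer than five elements,
  \<open>C\<close> would contain five rows in systematic form, which \<open>no_five_subsets\<close>
  excludes.\<close>

lemma exists_independent_subset:
  assumes "finite K" "card K = 9"
    and diff: "\<And>S T. S \<in> C \<Longrightarrow> T \<in> C \<Longrightarrow> sym_diff S T \<in> C"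
    and empty: "{} \<in> C"
    and wt: "\<And>S. S \<in> C \<Longrightarrow> card S mod 4 \<in> {0, 3}"
  obtains I where "I \<subseteq> K" "5 \<le> card I" "\<And>S. S \<subseteq> I \<Longrightarrow> S \<in> C \<Longrightarrow> S = {}"
    "\<And>S. S \<subseteq> K \<Longrightarrow> \<exists>T\<subseteq>I. sym_diff S T \<in> C"
proof -
  define indep where "indep I \<longleftrightarrow> (\<forall>S\<subseteq>I. S \<in> C \<longrightarrow> S = {})" for I
  have "\<exists>I\<in>{I. I \<subseteq> K \<and> indep I}. \<forall>I'\<in>{I. I \<subseteq> K \<and> indep I}. I \<subseteq> I' \<longrightarrow> I = I'"
  proof (rule finite_has_maximal)
    show "finite {I. I \<subseteq> K \<and> indep I}" using \<open>finite K\<close> by simp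
    show "{I. I \<subseteq> K \<and> indep I} \<noteq> {}" by (auto simp: indep_def)
  qed
  then obtain I where "I \<in> {I. I \<subseteq> K \<and> indep I}"
    and "\<forall>I'\<in>{I. I \<subseteq> K \<and> indep I}. I \<subseteq> I' \<longrightarrow> I = I'" by (rule bexE)
  then have I: "I \<subseteq> K" "indep I"
    and max: "\<And>I'. I' \<subseteq> K \<Longrightarrow> indep I' \<Longrightarrow> I \<subseteq> I' \<Longrightarrow> I = I'" by simp_all
  have "finite I" using I \<open>finite K\<close> finite_subset by blast
  \<comment> \<open>By maximality \<open>insert j I\<close> contains a nonempty codeword, and this
    must use \<open>j\<close>.\<close>
  have "\<exists>S\<subseteq>I. insert j S \<in> C" if j: "j \<in> K - I" for j
  proof -
    have "\<not> indep (insert j I)" using max[of "insert j I"] j I by blast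
    then obtain D where D: "D \<subseteq> insert j I" "D \<in> C" "D \<noteq> {}" unfolding indep_def by blast
    have "j \<in> D" using D I unfolding indep_def by blast
    then have "insert j (D - {j}) \<in> C" "D - {j} \<subseteq> I" using D by (auto simp: insert_absorb)
    then show ?thesis by blast
  qed
  then obtain R where R: "\<And>j. j \<in> K - I \<Longrightarrow> R j \<subseteq> I" "\<And>j. j \<in> K - I \<Longrightarrow> insert j (R j) \<in> C"
    by metis
  have "5 \<le> card I"
  proof (rule ccontr)
    assume "\<not> 5 \<le> card I"
    then have "5 \<le> card (K - I)"
      using I \<open>card K = 9\<close> \<open>finite I\<close> by (simp add: card_Diff_subset)
    \<comment> \<open>Exactly five leading columns are kept. The other four include
      \<open>I\<close>, even when \<open>I\<close> has fewer than four elements.\<close>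
    then obtain J where J: "J \<subseteq> K - I" "card J = 5"
      using obtain_subset_with_card_n by metis
    have J_K: "J \<subseteq> K" using J by blast
    have finJ: "finite J" using J_K \<open>finite K\<close> by (rule finite_subset)
    have IJ: "I \<subseteq> K - J" using I J by blast
    have card_KJ: "card (K - J) = 4"
      using card_Diff_subset[OF finJ J_K] J \<open>card K = 9\<close> by simp
    have RJ: "R j \<subseteq> K - J" if "j \<in> J" for j
      using R(1)[of j] J that IJ by blast
    have fin: "finite (R j)" if "j \<in> J" for j
      using RJ[OF that] \<open>finite K\<close> finite_subset by blast
    show False
    proof (rule no_five_subsets[of "K - J" J R])
      show "finite (K - J)" using \<open>finite K\<close> by simp
      show "card (K - J) = 4" "card J = 5" by fact+
      show "R j \<subseteq> K - J" if "j \<in> J" for j by (rule RJ[OF that])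
    next
      fix j assume j: "j \<in> J"
      have "j \<notin> R j" using RJ[OF j] j by blast
      \<comment> \<open>A row has weight \<open>1 + card (R j)\<close>, between 1 and 5, so it must
        be 3 or 4.\<close>
      then have "Suc (card (R j)) mod 4 \<in> {0, 3}"
        using wt[OF R(2)[of j]] j J fin[OF j] by auto
      moreover have "card (R j) \<le> 4"
        using RJ[OF j] card_KJ \<open>finite K\<close> card_mono[of "K - J" "R j"] by simp
      ultimately show "card (R j) \<in> {2, 3}" by simp presburger
    next
      fix j k assume jk: "j \<in> J" "k \<in> J" "j \<noteq> k"
      let ?D = "sym_diff (R j) (R k)"
      have sub: "?D \<subseteq> K - J" using RJ jk by blast
      have finD: "finite ?D" using fin jk by blast
      \<comment> \<open>The sum of two rows has weight \<open>2 + card ?D\<close>, between 2 and 6,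
        so again 3 or 4.\<close>
      have "sym_diff (insert j (R j)) (insert k (R k)) \<in> C"
        using jk J R by (intro diff) blast+
      moreover have "j \<notin> R j" "k \<notin> R k" "j \<notin> R k" "k \<notin> R j" using RJ jk by blast+
      then have "sym_diff (insert j (R j)) (insert k (R k)) = insert j (insert k ?D)"
        using jk by auto
      moreover have "j \<notin> insert k ?D" "k \<notin> ?D" using sub jk by blast+
      ultimately have "Suc (Suc (card ?D)) mod 4 \<in> {0, 3}"
        using wt finD by (metis card_insert_disjoint finite.insertI)
      moreover have "card ?D \<le> 4"
        using sub card_KJ \<open>finite K\<close> card_mono[of "K - J" ?D] by simp
      ultimately show "card ?D \<in> {1, 2}" by simp presburger
    qed
  qed
  moreover have "\<exists>T\<subseteq>I. sym_diff S T \<in> C" if "S \<subseteq> K" for S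
  proof -
    have "finite S" using that \<open>finite K\<close> by (rule finite_subset)
    then show ?thesis using that
    proof (induction S)
      case empty
      show ?case using \<open>{} \<in> C\<close> by (intro exI[of _ "{}"]) simp
    next
      case (insert j S)
      then obtain T where T: "T \<subseteq> I" "sym_diff S T \<in> C" by auto
      show ?case
      proof (cases "j \<in> I")
        case True
        \<comment> \<open>Flipping \<open>j\<close> in \<open>T\<close> cancels the new
          element.\<close>
        have "sym_diff (insert j S) (sym_diff T {j}) = sym_diff S T"
          using insert.hyps by auto
        moreover have "sym_diff T {j} \<subseteq> I" using T True by auto
        ultimately show ?thesis using T by metis
      next
        case False
        then have j: "j \<in> K - I" using insert.prems by auto
        \<comment> \<open>Adding this codeword trades \<open>j\<close> for the subset
          \<open>R j\<close> of \<open>I\<close>.\<close>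
        have "sym_diff (sym_diff S T) (insert j (R j)) \<in> C"
          by (rule diff[OF T(2) R(2)[OF j]])
        moreover have "sym_diff (sym_diff S T) (insert j (R j)) = sym_diff (insert j S) (sym_diff T (R j))"
          using insert.hyps T R(1)[OF j] j by auto
        moreover have "sym_diff T (R j) \<subseteq> I" using T R(1)[OF j] by blast
        ultimately show ?thesis by metis
      qed
    qed
  qed
  moreover have "S = {}" if "S \<subseteq> I" "S \<in> C" for S
    using that I unfolding indep_def by blast
  ultimately show ?thesis using I(1) by (intro that[of I])
qed

section \<open>Anticommuting square roots of -1 acting on lines\<close>

text \<open>A vector up to sign rather than its span. For unit vectors, the case of the application,
  both carry the same information.\<close>

definition line :: "'v::real_vector \<Rightarrow> 'v set" where
  "line v = {v, - v}"

lemma line_eq_iff: "line v = line w \<longleftrightarrow> v = w \<or> v = - w"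
  by (auto simp: line_def doubleton_eq_iff)

lemma line_minus [simp]: "line (- v) = line v"
  by (auto simp: line_def)

text \<open>The sum is the number of signs that arise when a product of \<open>n\<close>
  anticommuting square roots of -1 is squared.\<close>

lemma even_sum_atMost_iff: "even (\<Sum>{..n::nat}) \<longleftrightarrow> n mod 4 \<in> {0, 3}"
proof (induction n)
  case (Suc n)
  have "even (\<Sum>{..Suc n}) \<longleftrightarrow> (even (\<Sum>{..n}) \<longleftrightarrow> odd n)" by auto
  also have "\<dots> \<longleftrightarrow> (n mod 4 \<in> {0, 3} \<longleftrightarrow> odd n)" using Suc by simp
  also have "\<dots> \<longleftrightarrow> Suc n mod 4 \<in> {0, 3}" by simp presburger
  finally show ?case .
qed simp

text \<open>A representation of the Clifford algebra with \<open>card K\<close> generators of square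
  -1.\<close>

locale clifford_system =
  fixes K :: "'k set" and B :: "'k \<Rightarrow> 'v::real_vector \<Rightarrow> 'v"
  assumes finite_K: "finite K"
    and linear_B: "linear (B i)"
    and B_B: "i \<in> K \<Longrightarrow> B i (B i v) = - v"
    and anticommute: "i \<in> K \<Longrightarrow> j \<in> K \<Longrightarrow> i \<noteq> j \<Longrightarrow> B i (B j v) = - B j (B i v)"
begin

lemma B_minus: "B i (- v) = - B i v"
  using linear_B by (rule linear_neg)

lemma B_scaleR: "B i (c *\<^sub>R v) = c *\<^sub>R B i v"
  using linear_B by (rule linear_scale)

text \<open>Including both signs makes the maps \<open>act i\<close> commute on all sets.\<close>

definition act :: "'k \<Rightarrow> 'v set \<Rightarrow> 'v set" where
  "act i L = B i ` L \<union> uminus ` B i ` L"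

text \<open>A single point of the orbit, the line of \<open>B\<^sub>S y\<close>. Up to sign the
  order of the factors is immaterial, so a fold over the set makes sense.\<close>

definition orbit :: "'v \<Rightarrow> 'k set \<Rightarrow> 'v set" where
  "orbit y S = Finite_Set.fold act (line y) S"

lemma act_line [simp]: "act i (line v) = line (B i v)"
  by (auto simp: act_def line_def B_minus)

lemma act_commute: "i \<in> K \<Longrightarrow> j \<in> K \<Longrightarrow> act i (act j L) = act j (act i L)"
proof (cases "i = j")
  case False
  assume "i \<in> K" "j \<in> K"
  then have *: "B i (B j v) = - B j (B i v)" for v using False anticommute by blast
  show ?thesis
    unfolding act_def image_Un image_image B_minus * by auto
qed simp

sublocale fold_act: comp_fun_commute_on K act
  by unfold_locales (auto simp: act_commute)

lemma orbit_empty [simp]: "orbit y {} = line y"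
  by (simp add: orbit_def)

lemma orbit_insert:
  assumes "i \<in> K" "S \<subseteq> K" "i \<notin> S"
  shows "orbit y (insert i S) = act i (orbit y S)"
  unfolding orbit_def using assms finite_subset[OF _ finite_K]
  by (intro fold_act.fold_insert) auto

lemma orbit_set:
  assumes "distinct xs" "set xs \<subseteq> K"
  shows "orbit y (set xs) = line (foldr B xs y)"
  using assms by (induction xs) (auto simp: orbit_insert)

lemma orbit_is_line:
  assumes "S \<subseteq> K"
  obtains v where "orbit y S = line v"
  using finite_distinct_list[OF finite_subset[OF assms finite_K]] orbit_set assms by metis

lemma act_act: "i \<in> K \<Longrightarrow> act i (act i (line v)) = line v"
  by (simp add: B_B)

text \<open>On lines \<open>act i\<close> is an involution, because \<open>B i\<close> squares to
  -1. Thus inserting and removing \<open>i\<close> have the same effect, and subsets act as a group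
  under symmetric difference.\<close>

lemma orbit_flip:
  assumes "i \<in> K" "S \<subseteq> K"
  shows "orbit y (sym_diff S {i}) = act i (orbit y S)"
proof (cases "i \<in> S")
  case False
  then have "sym_diff S {i} = insert i S" by auto
  then show ?thesis using assms False by (simp add: orbit_insert)
next
  case True
  \<comment> \<open>\<open>act i\<close> is an involution only on sets closed under negation, so the
    orbit point is first written as a line.\<close>
  have "S - {i} \<subseteq> K" using assms by blast
  then obtain v where v: "orbit y (S - {i}) = line v" by (rule orbit_is_line)
  have "orbit y (insert i (S - {i})) = act i (line v)"
    using assms by (subst orbit_insert) (auto simp: v)
  then have "act i (orbit y S) = act i (act i (line v))"
    using True by (simp add: insert_absorb)
  also have "\<dots> = orbit y (S - {i})" using act_act assms(1) v by simp
  also have "S - {i} = sym_diff S {i}" using True by auto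
  finally show ?thesis by simp
qed

lemma orbit_sym_diff_cong:
  assumes "S \<subseteq> K" "S' \<subseteq> K" "T \<subseteq> K" "orbit y S = orbit y' S'"
  shows "orbit y (sym_diff S T) = orbit y' (sym_diff S' T)"
proof -
  have "finite T" using \<open>T \<subseteq> K\<close> finite_K by (rule finite_subset)
  then show ?thesis using assms
  proof (induction T)
    case (insert i T)
    have "sym_diff S (insert i T) = sym_diff (sym_diff S T) {i}"
      "sym_diff S' (insert i T) = sym_diff (sym_diff S' T) {i}"
      using insert.hyps by auto
    moreover have "sym_diff S T \<subseteq> K" "sym_diff S' T \<subseteq> K" "i \<in> K"
      using insert.prems by blast+
    ultimately show ?case
      using insert orbit_flip by (metis insert_subset)
  qed simp
qed

text \<open>The binary code of the argument: a subgroup of \<open>Pow K\<close> under symmetric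
  difference.\<close>

definition stabilizer :: "'v \<Rightarrow> 'k set set" where
  "stabilizer y = {S. S \<subseteq> K \<and> orbit y S = line y}"

text \<open>The orbit-stabilizer correspondence: orbit points are cosets. Both directions translate
  by \<open>T\<close>.\<close>

lemma orbit_eq_iff:
  assumes "S \<subseteq> K" "T \<subseteq> K"
  shows "orbit y S = orbit y T \<longleftrightarrow> sym_diff S T \<in> stabilizer y"
proof
  assume "orbit y S = orbit y T"
  from orbit_sym_diff_cong[OF assms assms(2) this]
  show "sym_diff S T \<in> stabilizer y"
    using assms by (auto simp: stabilizer_def)
next
  assume "sym_diff S T \<in> stabilizer y"
  then have *: "orbit y (sym_diff S T) = orbit y {}" by (simp add: stabilizer_def)
  have "sym_diff S T \<subseteq> K" using assms by blast
  from orbit_sym_diff_cong[OF this _ assms(2) *]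
  have "orbit y (sym_diff (sym_diff S T) T) = orbit y T" by simp
  moreover have "sym_diff (sym_diff S T) T = S" by blast
  ultimately show "orbit y S = orbit y T" by simp
qed

lemma foldr_B_anticommute:
  assumes "set xs \<subseteq> K" "x \<in> K" "x \<notin> set xs"
  shows "foldr B xs (B x v) = (- 1) ^ length xs *\<^sub>R B x (foldr B xs v)"
  using assms
proof (induction xs)
  case (Cons z zs)
  then have "foldr B (z # zs) (B x v) = (- 1) ^ length zs *\<^sub>R B z (B x (foldr B zs v))"
    by (simp add: B_scaleR)
  also have "B z (B x (foldr B zs v)) = - B x (B z (foldr B zs v))"
    using Cons.prems by (intro anticommute) auto
  finally show ?case by simp
qed simp

lemma foldr_B_minus: "foldr B xs (- v) = - foldr B xs v"
  by (induction xs) (auto simp: B_minus)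

text \<open>Moving the second copy of the first factor past the others costs
  \<open>length xs\<close> signs for the tail \<open>xs\<close>, and its square costs one more; the
  tail is handled by induction.\<close>

lemma foldr_B_foldr_B:
  assumes "distinct xs" "set xs \<subseteq> K"
  shows "foldr B xs (foldr B xs v) = (- 1) ^ (\<Sum>{..length xs}) *\<^sub>R v"
  using assms
proof (induction xs)
  case (Cons x xs)
  have "foldr B (x # xs) (foldr B (x # xs) v) =
      (- 1) ^ length xs *\<^sub>R B x (B x (foldr B xs (foldr B xs v)))"
    using Cons.prems by (simp add: foldr_B_anticommute B_scaleR)
  also have "B x (B x (foldr B xs (foldr B xs v))) = (- ((- 1) ^ (\<Sum>{..length xs}))) *\<^sub>R v"
    using Cons by (simp add: B_B)
  finally show ?case by (simp add: power_add mult.commute)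
qed simp

text \<open>If a product maps \<open>y\<close> to \<open>y\<close> or \<open>- y\<close>, applying
  it twice fixes \<open>y\<close>. Its square is a global sign, which must be 1 because
  \<open>y\<close> is nonzero.\<close>

lemma card_stabilizer_mod_4:
  assumes "S \<in> stabilizer y" "y \<noteq> 0"
  shows "card S mod 4 \<in> {0, 3}"
proof -
  have S: "S \<subseteq> K" "orbit y S = line y" using assms by (auto simp: stabilizer_def)
  then obtain xs where xs: "set xs = S" "distinct xs"
    using finite_distinct_list finite_subset finite_K by metis
  have "line (foldr B xs y) = line y" using S orbit_set[of xs y] xs by simp
  then have "foldr B xs (foldr B xs y) = y"
    by (auto simp: line_eq_iff foldr_B_minus)
  then have "(- 1) ^ (\<Sum>{..length xs}) *\<^sub>R y = y"
    using foldr_B_foldr_B[of xs y] xs S by simp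
  then have "(- 1 :: real) ^ (\<Sum>{..length xs}) = 1"
    using assms(2) by (metis scaleR_one scaleR_cancel_right)
  then have "even (\<Sum>{..length xs})"
    by (cases "even (\<Sum>{..length xs})") simp_all
  moreover have "card S = length xs" using xs distinct_card by blast
  ultimately show ?thesis by (simp add: even_sum_atMost_iff)
qed


text \<open>These lines are the orbit points of the empty set and the singletons. A coincidence
  would put a set of size 1 or 2 into the stabilizer.\<close>

lemma card_lines_through:
  assumes "y \<noteq> 0"
  shows "card (insert (line y) ((\<lambda>i. line (B i y)) ` K)) = Suc (card K)"
proof -
  have eq: "insert (line y) ((\<lambda>i. line (B i y)) ` K) = orbit y ` insert {} ((\<lambda>i. {i}) ` K)"
    using orbit_set[of "[_]" y] by (auto simp: image_image)
  have "inj_on (orbit y) (insert {} ((\<lambda>i. {i}) ` K))"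
  proof (rule inj_onI)
    fix S T assume S: "S \<in> insert {} ((\<lambda>i. {i}) ` K)" and T: "T \<in> insert {} ((\<lambda>i. {i}) ` K)"
      and eq: "orbit y S = orbit y T"
    have "S \<subseteq> K" "T \<subseteq> K" using S T by auto
    then have "sym_diff S T \<in> stabilizer y" using eq orbit_eq_iff by simp
    then have wt: "card (sym_diff S T) mod 4 \<in> {0, 3}"
      using assms by (rule card_stabilizer_mod_4)
    show "S = T"
    proof (rule ccontr)
      assume "S \<noteq> T"
      then have "card (sym_diff S T) \<in> {1, 2}"
        using S T by (auto simp: insert_Diff_if)
      then show False using wt by auto
    qed
  qed
  moreover have "card (insert {} ((\<lambda>i. {i}) ` K)) = Suc (card K)"
    using finite_K by (subst card_insert_disjoint) (auto simp: card_image)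
  ultimately show ?thesis by (simp only: eq card_image)
qed

lemma lines_exceed_16:
  assumes K: "card K = 9" and "0 \<notin> Y" and Y: "card (line ` Y) = 10"
    and W: "finite \<W>" "card \<W> \<le> 16"
    and line_W: "\<And>y. y \<in> Y \<Longrightarrow> line y \<in> \<W>"
    and line_B_W: "\<And>i y. i \<in> K \<Longrightarrow> y \<in> Y \<Longrightarrow> line (B i y) \<in> \<W>"
  shows False
proof -
  obtain y where y: "y \<in> Y" using Y by fastforce
  then have "y \<noteq> 0" using \<open>0 \<notin> Y\<close> by blast
  define N where "N z = insert (line z) ((\<lambda>i. line (B i z)) ` K)" for z
  have line_Y: "\<exists>S\<subseteq>K. line z = orbit y S" if z: "z \<in> Y" for z
  proof -
    have "N z \<subseteq> \<W>" "N y \<subseteq> \<W>" using z y line_W line_B_W by (auto simp: N_def)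
    moreover have "card (N v) = 10" if "v \<in> Y" for v
      using card_lines_through[of v] K that \<open>0 \<notin> Y\<close> by (auto simp: N_def)
    then have "card (N z) = 10" "card (N y) = 10" using z y by blast+
    \<comment> \<open>Disjoint neighbourhoods would occupy 20 of at most 16 lines.\<close>
    ultimately have "N z \<inter> N y \<noteq> {}"
      using card_Un_disjoint[of "N z" "N y"] card_mono[of \<W> "N z \<union> N y"] W
      by (auto simp: finite_subset)
    then obtain L where L: "L \<in> N z" "L \<in> N y" by blast
    obtain T where T: "T \<subseteq> K" "L = orbit y T"
    proof (cases "L = line y")
      case True
      then show ?thesis using that[of "{}"] by simp
    next
      case False
      then obtain i where "i \<in> K" "L = line (B i y)" using L by (auto simp: N_def)
      then show ?thesis using that[of "{i}"] orbit_set[of "[i]" y] by simp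
    qed
    show ?thesis
    proof (cases "L = line z")
      case True
      then show ?thesis using T by blast
    next
      case False
      then obtain i where i: "i \<in> K" "L = line (B i z)" using L by (auto simp: N_def)
      \<comment> \<open>A second application of \<open>B i\<close> leads back to the line of
        \<open>z\<close>.\<close>
      then have "act i L = line z" by (simp add: B_B)
      then have "line z = act i (orbit y T)" using T by simp
      also have "\<dots> = orbit y (sym_diff T {i})" using i T by (simp add: orbit_flip)
      finally show ?thesis using T i by (intro exI[of _ "sym_diff T {i}"]) auto
    qed
  qed
  obtain I where I: "I \<subseteq> K" "5 \<le> card I"
    and indep: "\<And>S. S \<subseteq> I \<Longrightarrow> S \<in> stabilizer y \<Longrightarrow> S = {}"
    and span: "\<And>S. S \<subseteq> K \<Longrightarrow> \<exists>T\<subseteq>I. sym_diff S T \<in> stabilizer y"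
  proof (rule exists_independent_subset[of K "stabilizer y"])
    show "{} \<in> stabilizer y" by (simp add: stabilizer_def)
    show "card S mod 4 \<in> {0, 3}" if "S \<in> stabilizer y" for S
      using that \<open>y \<noteq> 0\<close> by (rule card_stabilizer_mod_4)
    show "sym_diff S T \<in> stabilizer y" if "S \<in> stabilizer y" "T \<in> stabilizer y" for S T
      using that by (subst orbit_eq_iff[symmetric]) (auto simp: stabilizer_def)
  qed (use K finite_K in auto)
  have inj: "inj_on (orbit y) (Pow I)"
  proof (rule inj_onI)
    fix S T assume ST: "S \<in> Pow I" "T \<in> Pow I" "orbit y S = orbit y T"
    then have "sym_diff S T \<in> stabilizer y"
      using I orbit_eq_iff[of S T y] by blast
    then have "sym_diff S T = {}" using ST by (intro indep) auto
    then show "S = T" by blast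
  qed
  \<comment> \<open>The ten lines as hypercube vertices: \<open>span\<close> provides a
    representative within \<open>I\<close> for each, and \<open>inj\<close> makes it unique.\<close>
  define \<B> where "\<B> = {S. S \<subseteq> I \<and> orbit y S \<in> line ` Y}"
  have B_Pow: "\<B> \<subseteq> Pow I" by (auto simp: \<B>_def)
  have "orbit y ` \<B> = line ` Y"
  proof
    show "line ` Y \<subseteq> orbit y ` \<B>"
    proof
      fix L assume L: "L \<in> line ` Y"
      then obtain S where S: "S \<subseteq> K" "L = orbit y S" using line_Y by blast
      obtain T where T: "T \<subseteq> I" "sym_diff S T \<in> stabilizer y" using span[OF S(1)] by blast
      then have "L = orbit y T" using orbit_eq_iff[of S T y] S I by blast
      then show "L \<in> orbit y ` \<B>" using T L by (auto simp: \<B>_def)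
    qed
  qed (auto simp: \<B>_def)
  then have "card \<B> = 10"
    using card_image[OF inj_on_subset[OF inj B_Pow]] Y by simp
  moreover have "finite I" using I finite_K finite_subset by blast
  ultimately have "20 \<le> card (nbhd I \<B>)"
    using card_nbhd_ge[of I \<B>] I B_Pow by simp
  also have "\<dots> = card (orbit y ` nbhd I \<B>)"
    using card_image[OF inj_on_subset[OF inj nbhd_subset_Pow[OF B_Pow]]] by simp
  also have "\<dots> \<le> card \<W>"
  proof (rule card_mono[OF W(1)])
    show "orbit y ` nbhd I \<B> \<subseteq> \<W>"
    proof
      fix L assume "L \<in> orbit y ` nbhd I \<B>"
      then consider S where "S \<in> \<B>" "L = orbit y S"
        | i S where "i \<in> I" "S \<in> \<B>" "L = orbit y (sym_diff S {i})"
        unfolding nbhd_def by blast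
      then show "L \<in> \<W>"
      proof cases
        case 1
        then show ?thesis using line_W by (auto simp: \<B>_def)
      next
        case 2
        then have "i \<in> K" "S \<subseteq> K" using I B_Pow by auto
        then have "L = act i (orbit y S)" using 2 orbit_flip by blast
        moreover obtain z where "z \<in> Y" "orbit y S = line z" using 2 by (auto simp: \<B>_def)
        ultimately show ?thesis using line_B_W \<open>i \<in> K\<close> by simp
      qed
    qed
  qed
  finally show False using W by simp
qed

end

section \<open>Clifford systems from square normed bilinear maps\<close>

text \<open>Polarisation. The factor \<open>c\<close> covers maps such as
  \<open>\<lambda>x. F x u\<close>, which scale lengths by \<open>norm u\<close>.\<close>

lemma inner_preserving:
  fixes f :: "'a::real_inner \<Rightarrow> 'b::real_inner"
  assumes "linear f" "\<And>x. norm (f x) = c * norm x"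
  shows "f x \<bullet> f y = c\<^sup>2 * (x \<bullet> y)"
proof -
  have "(norm (f x + f y))\<^sup>2 = (c * norm (x + y))\<^sup>2"
    using assms by (simp add: linear_add[OF assms(1), symmetric])
  then show ?thesis
    unfolding dot_norm assms(2) power_mult_distrib by (simp add: algebra_simps diff_divide_distrib)
qed

text \<open>The hypotheses are the Hurwitz matrix equations. Composing with the adjoint of
  \<open>A k\<close> turns \<open>A k\<close> into the identity and the other maps into orthogonal,
  skew-adjoint, anticommuting ones.\<close>

lemma clifford_system_adjoint:
  fixes A :: "'k::finite \<Rightarrow> 'v::euclidean_space \<Rightarrow> 'v"
  assumes linear_A: "\<And>i. linear (A i)"
    and inner_A: "\<And>i u v. A i u \<bullet> A i v = u \<bullet> v"
    and orthogonal_A: "\<And>i j u. i \<noteq> j \<Longrightarrow> A i u \<bullet> A j u = 0"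
  shows "clifford_system (UNIV - {k}) (\<lambda>i v. adjoint (A k) (A i v))"
    and "adjoint (A k) (A k v) = v"
proof -
  define T where "T = adjoint (A k)"
  have inner_T: "u \<bullet> T v = A k u \<bullet> v" for u v
    unfolding T_def by (rule adjoint_works[OF linear_A])
  have linear_T: "linear T"
    unfolding T_def by (rule adjoint_linear[OF linear_A])
  have T_A: "T (A k v) = v" for v
    by (rule vector_eq_ldot[THEN iffD1]) (simp add: inner_T inner_A)
  then show "adjoint (A k) (A k v) = v" by (simp add: T_def)
  \<comment> \<open>An isometry of a finite-dimensional space into itself is onto, so its left
    inverse \<open>T\<close> is an isometry too. Here domain and codomain must agree, as they do for
    \<open>F\<close> but not for \<open>g\<close>.\<close>
  have "inj (A k)" using T_A by (metis injI)
  then have "surj (A k)" using linear_A linear_injective_imp_surjective by blast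
  then have T_T: "T u \<bullet> T v = u \<bullet> v" for u v
    by (metis T_A inner_A surjD)
  \<comment> \<open>Orthogonality at \<open>u + v\<close>, expanded.\<close>
  have skew: "A i u \<bullet> A j v = - (A i v \<bullet> A j u)" if "i \<noteq> j" for i j u v
    using orthogonal_A[OF that, of "u + v"] orthogonal_A[OF that]
    by (simp add: linear_add[OF linear_A] inner_add_left inner_add_right)
  have T_skew: "u \<bullet> T (A i v) = - (v \<bullet> T (A i u))" if "i \<noteq> k" for i u v
    using skew[of k i u v] that by (simp add: inner_T)
  show "clifford_system (UNIV - {k}) (\<lambda>i v. adjoint (A k) (A i v))"
    unfolding T_def[symmetric]
  proof (rule clifford_system.intro)
    show "linear (\<lambda>v. T (A i v))" for i
      using linear_compose[OF linear_A linear_T] by (simp add: o_def)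
    \<comment> \<open>Skew-adjoint and orthogonal together give square -1; the identity is tested by
      inner products with all vectors.\<close>
    show "T (A i (T (A i v))) = - v" if "i \<in> UNIV - {k}" for i v
      by (rule vector_eq_ldot[THEN iffD1])
        (use that in \<open>simp add: T_skew[of i _ "T (A i v)"] T_T inner_A inner_commute\<close>)
    \<comment> \<open>Moving the outer skew-adjoint map to the other side reduces anticommutation to
      \<open>skew\<close>.\<close>
    show "T (A i (T (A j v))) = - T (A j (T (A i v)))"
      if "i \<in> UNIV - {k}" "j \<in> UNIV - {k}" "i \<noteq> j" for i j v
    proof (rule vector_eq_ldot[THEN iffD1], rule allI)
      fix u
      have "u \<bullet> T (A i (T (A j v))) = - (A j v \<bullet> A i u)"
        using that by (simp add: T_skew[of i u] T_T)
      moreover have "u \<bullet> T (A j (T (A i v))) = - (A i v \<bullet> A j u)"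
        using that by (simp add: T_skew[of j u] T_T)
      ultimately show "u \<bullet> T (A i (T (A j v))) = u \<bullet> - T (A j (T (A i v)))"
        using skew[of i j v u] that by (simp add: inner_commute)
    qed
  qed simp
qed

section \<open>Integer formulas and the conclusion\<close>

text \<open>A nonzero integer coordinate already contributes at least 1 to the sum of squares, which
  leaves nothing for the others.\<close>

lemma integer_unit_vector:
  fixes v :: "real^'n"
  assumes "\<And>k. v $ k \<in> \<int>" "norm v = 1"
  obtains k where "v = axis k 1 \<or> v = - axis k 1"
proof -
  have sum: "(\<Sum>k\<in>UNIV. (v $ k)\<^sup>2) = 1"
    using assms(2) by (simp add: norm_vec_def L2_set_def)
  have "v \<noteq> 0" using assms(2) by auto
  then obtain k where k: "v $ k \<noteq> 0" by (auto simp: vec_eq_iff)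
  have ge: "1 \<le> \<bar>v $ k\<bar>" using assms(1) k Ints_nonzero_abs_ge1 by blast
  then have "1 \<le> (v $ k)\<^sup>2" using one_le_power[of "\<bar>v $ k\<bar>" 2] by simp
  moreover have "(\<Sum>j\<in>UNIV. (v $ j)\<^sup>2) = (v $ k)\<^sup>2 + (\<Sum>j\<in>UNIV - {k}. (v $ j)\<^sup>2)"
    by (rule sum.remove) auto
  moreover have "0 \<le> (\<Sum>j\<in>UNIV - {k}. (v $ j)\<^sup>2)" by (intro sum_nonneg) simp
  ultimately have "(v $ k)\<^sup>2 = 1" "(\<Sum>j\<in>UNIV - {k}. (v $ j)\<^sup>2) = 0"
    using sum by linarith+
  then have "v $ k = 1 \<or> v $ k = -1" "\<And>j. j \<noteq> k \<Longrightarrow> v $ j = 0"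
    by (auto simp: power2_eq_1_iff sum_nonneg_eq_0_iff)
  then have "v = axis k 1 \<or> v = - axis k 1" by (auto simp: vec_eq_iff axis_def)
  then show ?thesis by (rule that)
qed

text \<open>At basis vectors each coordinate of \<open>g\<close> is a coefficient
  \<open>c i j\<close>, hence an integer, and normedness gives length 1.\<close>

lemma integer_formula_axis:
  fixes g :: "real^'r \<Rightarrow> real^'s \<Rightarrow> real^'n"
  assumes "integer_formula g"
  obtains k where "g (axis i 1) (axis j 1) = axis k 1 \<or> g (axis i 1) (axis j 1) = - axis k 1"
proof (rule integer_unit_vector)
  show "norm (g (axis i 1) (axis j 1)) = 1"
    using assms by (simp add: integer_formula_def real_formula_def)
  fix k
  obtain c :: "'r \<Rightarrow> 's \<Rightarrow> int" where
    "\<And>x y. g x y $ k = (\<Sum>i\<in>UNIV. \<Sum>j\<in>UNIV. of_int (c i j) * x $ i * y $ j)"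
    using assms unfolding integer_formula_def by blast
  then show "g (axis i 1) (axis j 1) $ k \<in> \<int>"
    by (auto simp: axis_def intro!: Ints_sum Ints_mult)
qed

theorem corollary1:
  fixes g :: "real^10 \<Rightarrow> real^10 \<Rightarrow> real^16"
    and F :: "real^'h \<Rightarrow> real^'m \<Rightarrow> real^'m"
  assumes "integer_formula g"
    and "hurwitz_radon_formula F"
  shows "\<not> is_restriction g F"
proof
  assume "is_restriction g F"
  then obtain \<alpha> \<beta> \<gamma>
    where \<alpha>: "linear \<alpha>" "\<And>x. norm (\<alpha> x) = norm x"
      and \<beta>: "linear \<beta>" "\<And>x. norm (\<beta> x) = norm x"
      and \<gamma>: "linear \<gamma>"
      and eq: "\<And>x y. \<gamma> (g x y) = F (\<alpha> x) (\<beta> y)"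
    unfolding is_restriction_def linear_isometry_onto_def by blast
  have F: "bilinear F" "\<And>x y. norm (F x y) = norm x * norm y"
    using assms(2) by (auto simp: hurwitz_radon_formula_def real_formula_def)
  have linear_F: "linear (F x)" "linear (\<lambda>x. F x y)" for x y
    using F(1) by (auto simp: bilinear_def)
  define A where "A i = F (\<alpha> (axis i 1))" for i
  have linear_A: "linear (A i)" for i by (simp add: A_def linear_F)
  have inner_A: "A i u \<bullet> A i v = u \<bullet> v" for i u v
    using inner_preserving[OF linear_A, of i 1 u v] by (simp add: A_def F(2) \<alpha>(2))
  have orthogonal_A: "A i u \<bullet> A j u = 0" if "i \<noteq> j" for i j u
  proof -
    have "A i u \<bullet> A j u = (norm u)\<^sup>2 * (\<alpha> (axis i 1) \<bullet> \<alpha> (axis j 1))"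
      unfolding A_def by (rule inner_preserving[OF linear_F(2)]) (simp add: F(2))
    also have "\<alpha> (axis i 1) \<bullet> \<alpha> (axis j 1) = 0"
      using inner_preserving[OF \<alpha>(1), of 1 "axis i 1" "axis j 1"] \<alpha>(2) that
      by (simp add: inner_axis_axis)
    finally show ?thesis by simp
  qed
  \<comment> \<open>Index 0 of the type \<open>10\<close> is the reference; the other nine give the
    Clifford system.\<close>
  define T where "T = adjoint (A 0)"
  interpret clifford_system "UNIV - {0}" "\<lambda>i v. T (A i v)"
    unfolding T_def by (rule clifford_system_adjoint[OF linear_A inner_A orthogonal_A])
  have T_A: "T (A 0 v) = v" for v
    unfolding T_def by (rule clifford_system_adjoint[OF linear_A inner_A orthogonal_A])
  have linear_T: "linear T" unfolding T_def by (rule adjoint_linear[OF linear_A])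
  \<comment> \<open>The lines of the 16 basis vectors of the target of \<open>g\<close>, carried
    over by \<open>\<gamma>\<close> and \<open>T\<close>.\<close>
  define \<W> where "\<W> = range (\<lambda>k. line (T (\<gamma> (axis k 1))))"
  have A_W: "line (T (A i (\<beta> (axis j 1)))) \<in> \<W>" for i j
  proof -
    obtain k where "g (axis i 1) (axis j 1) = axis k 1 \<or> g (axis i 1) (axis j 1) = - axis k 1"
      using integer_formula_axis[OF assms(1)] .
    then have "line (T (\<gamma> (g (axis i 1) (axis j 1)))) = line (T (\<gamma> (axis k 1)))"
      by (auto simp: linear_neg[OF \<gamma>] linear_neg[OF linear_T])
    then show ?thesis by (auto simp: \<W>_def A_def eq)
  qed
  define Y where "Y = range (\<lambda>j. \<beta> (axis j 1))"
  have inner_\<beta>: "\<beta> (axis i 1) \<bullet> \<beta> (axis j 1) = (if i = j then 1 else 0)" for i j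
    using inner_preserving[OF \<beta>(1), of 1 "axis i 1" "axis j 1"] \<beta>(2)
    by (simp add: inner_axis_axis)
  have "inj (\<lambda>j. line (\<beta> (axis j 1)))"
  proof (rule injI)
    fix i j assume "line (\<beta> (axis i 1)) = line (\<beta> (axis j 1))"
    \<comment> \<open>Equal lines would force inner product 1 or -1, against orthonormality.\<close>
    then have "\<bar>\<beta> (axis i 1) \<bullet> \<beta> (axis j 1)\<bar> = 1"
      using inner_\<beta>[of j j] by (auto simp: line_eq_iff)
    then show "i = j" by (simp add: inner_\<beta> split: if_splits)
  qed
  then have "card (line ` Y) = 10"
    using card_image[of "\<lambda>j. line (\<beta> (axis j 1))" UNIV] by (simp add: Y_def image_image)
  moreover have "0 \<notin> Y"
    using inner_\<beta> by (auto simp: Y_def) (metis inner_zero_left zero_neq_one)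
  moreover have "card \<W> \<le> 16"
    using card_image_le[of UNIV "\<lambda>k. line (T (\<gamma> (axis k 1)))"] by (simp add: \<W>_def)
  \<comment> \<open>Since \<open>T (A 0 y) = y\<close>, this is the case \<open>i = 0\<close> of
    \<open>A_W\<close>.\<close>
  moreover have "line y \<in> \<W>" if "y \<in> Y" for y
    using A_W[of 0] that by (auto simp: Y_def T_A)
  moreover have "line (T (A i y)) \<in> \<W>" if "y \<in> Y" for i y
    using A_W that by (auto simp: Y_def)
  ultimately show False
    by (intro lines_exceed_16[of Y \<W>]) (auto simp: \<W>_def)
qed

end
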